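(* Let $d>0$ be a squarefree integer. There exist constants $0<l_1(d)\le l_2(d)$ such that $$l_1(d)T^4\precsim \mathrm{N}_d(T)\precsim l_2(d)T^4 .$$
   Context: $\mathcal{O}_d=\mathbb{Z}[\omega]$ is the ring of integers of $\mathbb{Q}(\sqrt{-d})$, with $\omega=\frac{-1+\sqrt{-d}}{2}$ if $d\equiv3\pmod4$ and $\omega=\sqrt{-d}$ otherwise, and $\Gamma_d=\mathrm{PSL}(2,\mathcal{O}_d)$. The height $\mathrm{H}(A)$ of $A\in\Gamma_d$ is the maximum of the complex absolute values of the entries of a representative matrix in $\mathrm{SL}(2,\mathcal{O}_d)$. $\mathrm{N}_d(T)=\#\{A\in\Gamma_d:\mathrm{H}(A)\le T\}$. For positive functions $f,g$, $f(T)\precsim g(T)$ means $\limsup_{T\to\infty} f(T)/g(T)\le 1$. *)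

theory Defs
  imports
    "HOL-Analysis.Analysis"
    "HOL-Algebra.Coset"
    "HOL-Computational_Algebra.Polynomial"
    "HOL-Computational_Algebra.Squarefree"
begin

definition omega :: "int \<Rightarrow> complex" where
  "omega d = (if d mod 4 = 3 then (- 1 + csqrt (- of_int d)) / 2 else csqrt (- of_int d))"

definition quad_int_ring :: "int \<Rightarrow> complex set" where
  "quad_int_ring d = (\<lambda>p :: int poly. poly (map_poly of_int p) (omega d)) ` UNIV"

definition SL2 :: "int \<Rightarrow> (complex^2^2) monoid" where
  "SL2 d = \<lparr>carrier = {A. (\<forall>i j. A $ i $ j \<in> quad_int_ring d) \<and> det A = 1},
            monoid.mult = (**), one = mat 1\<rparr>"

definition PSL2 :: "int \<Rightarrow> (complex^2^2) set monoid" where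
  "PSL2 d = SL2 d Mod {mat 1, - mat 1}"

definition mat_height :: "complex^2^2 \<Rightarrow> real" where
  "mat_height A = Max {cmod (A $ i $ j) | i j. True}"

text \<open>All representatives of a class have the same \<open>mat_height\<close>; see \<open>height_eq\<close> below.\<close>
definition height :: "(complex^2^2) set \<Rightarrow> real" where
  "height X = (THE h. \<exists>A\<in>X. h = mat_height A)"

text \<open>The counted set is finite (\<open>finite_height_le\<close> below), so \<open>card\<close> is its number of elements.\<close>
definition count_height :: "int \<Rightarrow> real \<Rightarrow> nat" where
  "count_height d T = card {A \<in> carrier (PSL2 d). height A \<le> T}"

definition asymp_le :: "(real \<Rightarrow> real) \<Rightarrow> (real \<Rightarrow> real) \<Rightarrow> bool" where
  "asymp_le f g \<longleftrightarrow> Limsup at_top (\<lambda>T. ereal (f T / g T)) \<le> 1"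


lemma csqrt_neg_square: "csqrt (- of_int d) * csqrt (- of_int d) = - of_int d"
  by (metis power2_csqrt power2_eq_square)

lemma omega_quadratic: "\<exists>r s::int. omega d * omega d = of_int r + of_int s * omega d"
proof (cases "d mod 4 = 3")
  case True
  then obtain k where k: "d = 4 * k + 3" by (metis mult_div_mod_eq)
  have "omega d * omega d = of_int (- (k + 1)) + of_int (- 1) * omega d"
    using True csqrt_neg_square[of d] unfolding omega_def
    by (simp add: field_simps) (simp add: k algebra_simps)
  then show ?thesis by blast
next
  case False
  then have "omega d * omega d = of_int (- d) + of_int 0 * omega d"
    using csqrt_neg_square[of d] by (simp add: omega_def)
  then show ?thesis by blast
qed

lemma quad_int_ring_eq:
  "quad_int_ring d = {of_int a + of_int b * omega d | a b. True}"
proof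
  obtain r s where rs: "omega d * omega d = of_int r + of_int s * omega d"
    using omega_quadratic by blast
  have "\<exists>a b. poly (map_poly of_int p) (omega d) = of_int a + of_int b * omega d" for p :: "int poly"
  proof (induction p)
    case 0
    have "poly (map_poly of_int 0) (omega d) = of_int 0 + of_int 0 * omega d" by simp
    then show ?case by blast
  next
    case (pCons c p)
    then obtain a b where ab: "poly (map_poly of_int p) (omega d) = of_int a + of_int b * omega d"
      by blast
    have "poly (map_poly of_int (pCons c p)) (omega d)
        = of_int c + omega d * (of_int a + of_int b * omega d)"
      by (simp add: map_poly_pCons ab)
    also have "\<dots> = of_int c + of_int a * omega d + of_int b * (omega d * omega d)"
      by (simp add: algebra_simps)
    also have "\<dots> = of_int (c + b * r) + of_int (a + b * s) * omega d"
      by (simp add: rs algebra_simps)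
    finally show ?case by blast
  qed
  then show "quad_int_ring d \<subseteq> {of_int a + of_int b * omega d | a b. True}"
    unfolding quad_int_ring_def by auto
  have "of_int a + of_int b * omega d = poly (map_poly of_int [:a, b:]) (omega d)" for a b
    by (simp add: map_poly_pCons algebra_simps)
  then show "{of_int a + of_int b * omega d | a b. True} \<subseteq> quad_int_ring d"
    unfolding quad_int_ring_def by blast
qed

lemma quad_int_ring_closed:
  assumes "x \<in> quad_int_ring d" "y \<in> quad_int_ring d"
  shows "x + y \<in> quad_int_ring d" "- x \<in> quad_int_ring d" "x * y \<in> quad_int_ring d"
proof -
  obtain r s where rs: "omega d * omega d = of_int r + of_int s * omega d"
    using omega_quadratic by blast
  obtain a b a' b' where x: "x = of_int a + of_int b * omega d" and y: "y = of_int a' + of_int b' * omega d"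
    using assms unfolding quad_int_ring_eq by blast
  have "x + y = of_int (a + a') + of_int (b + b') * omega d"
    "- x = of_int (- a) + of_int (- b) * omega d"
    by (simp_all add: x y algebra_simps)
  then show "x + y \<in> quad_int_ring d" "- x \<in> quad_int_ring d"
    unfolding quad_int_ring_eq by blast+
  have "x * y = of_int (a * a') + of_int (a * b' + a' * b) * omega d
      + of_int (b * b') * (omega d * omega d)"
    by (simp add: x y algebra_simps)
  also have "\<dots> = of_int (a * a' + b * b' * r) + of_int (a * b' + a' * b + b * b' * s) * omega d"
    by (simp add: rs algebra_simps)
  finally show "x * y \<in> quad_int_ring d"
    unfolding quad_int_ring_eq by blast
qed

lemma zero_one_in_quad_int_ring: "0 \<in> quad_int_ring d" "1 \<in> quad_int_ring d"
proof -
  have "0 = of_int 0 + of_int 0 * omega d" "1 = of_int 1 + of_int 0 * omega d" by simp_all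
  then show "0 \<in> quad_int_ring d" "1 \<in> quad_int_ring d" unfolding quad_int_ring_eq by blast+
qed

lemma SL2_simps:
  "carrier (SL2 d) = {A. (\<forall>i j. A $ i $ j \<in> quad_int_ring d) \<and> det A = 1}"
  "A \<otimes>\<^bsub>SL2 d\<^esub> B = A ** B" "\<one>\<^bsub>SL2 d\<^esub> = mat 1"
  by (simp_all add: SL2_def)

lemma group_SL2: "group (SL2 d)"
proof (rule groupI)
  show "A \<otimes>\<^bsub>SL2 d\<^esub> B \<in> carrier (SL2 d)" if "A \<in> carrier (SL2 d)" "B \<in> carrier (SL2 d)" for A B
  proof -
    have "(A ** B) $ i $ j \<in> quad_int_ring d" for i j
      using that by (auto simp: SL2_simps matrix_matrix_mult_def sum_2 intro!: quad_int_ring_closed)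
    then show ?thesis using that by (simp add: SL2_simps det_mul)
  qed
  show "\<one>\<^bsub>SL2 d\<^esub> \<in> carrier (SL2 d)"
    unfolding SL2_simps by (simp add: forall_2 det_2) (simp add: mat_def zero_one_in_quad_int_ring)
  show "A \<otimes>\<^bsub>SL2 d\<^esub> B \<otimes>\<^bsub>SL2 d\<^esub> C = A \<otimes>\<^bsub>SL2 d\<^esub> (B \<otimes>\<^bsub>SL2 d\<^esub> C)" for A B C
    by (simp add: SL2_simps matrix_mul_assoc)
  show "\<one>\<^bsub>SL2 d\<^esub> \<otimes>\<^bsub>SL2 d\<^esub> A = A" for A
    by (simp add: SL2_simps)
  show "\<exists>B\<in>carrier (SL2 d). B \<otimes>\<^bsub>SL2 d\<^esub> A = \<one>\<^bsub>SL2 d\<^esub>" if "A \<in> carrier (SL2 d)" for A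
  proof -
    define B :: "complex^2^2" where "B = vector [vector [A$2$2, - A$1$2], vector [- A$2$1, A$1$1]]"
    have B: "B$1$1 = A$2$2" "B$1$2 = - A$1$2" "B$2$1 = - A$2$1" "B$2$2 = A$1$1"
      by (simp_all add: B_def)
    have "det A = 1" "\<And>i j. A$i$j \<in> quad_int_ring d" using that by (auto simp: SL2_simps)
    then have "B \<in> carrier (SL2 d)"
      by (auto simp: SL2_simps forall_2 B det_2 algebra_simps intro: quad_int_ring_closed)
    moreover have "B ** A = mat 1"
      using \<open>det A = 1\<close>
      by (simp add: vec_eq_iff forall_2 matrix_matrix_mult_def sum_2 B mat_def det_2 algebra_simps)
    ultimately show ?thesis by (auto simp: SL2_simps)
  qed
qed

lemma mat_neg_simps [simp]:
  fixes A :: "complex^2^2"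
  shows "- mat 1 ** A = - A" "A ** - mat 1 = - A"
  by (simp_all add: vec_eq_iff forall_2 matrix_matrix_mult_def sum_2 mat_def)

lemma centre_normal: "{mat 1, - mat 1} \<lhd> SL2 d"
proof -
  interpret group "SL2 d" by (rule group_SL2)
  have neg: "- mat 1 \<in> carrier (SL2 d)"
    by (auto simp: SL2_simps forall_2 mat_def det_2 intro: quad_int_ring_closed zero_one_in_quad_int_ring)
  have one: "mat 1 \<in> carrier (SL2 d)" using one_closed by (simp add: SL2_simps)
  have "inv\<^bsub>SL2 d\<^esub> (- mat 1) = - mat 1"
    by (rule inv_equality) (use neg in \<open>auto simp: SL2_simps(2,3)\<close>)
  moreover have "inv\<^bsub>SL2 d\<^esub> (mat 1) = mat 1"
    by (rule inv_equality) (use one in \<open>auto simp: SL2_simps(2,3)\<close>)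
  ultimately have "subgroup {mat 1, - mat 1} (SL2 d)"
    by (intro subgroupI) (use neg one in \<open>auto simp: SL2_simps(2,3)\<close>)
  then show ?thesis
    by (rule normalI) (auto simp: r_coset_def l_coset_def SL2_simps)
qed

lemma carrier_PSL2: "carrier (PSL2 d) = {{A, - A} | A. A \<in> carrier (SL2 d)}"
  by (auto simp: PSL2_def carrier_FactGroup r_coset_def SL2_simps(2))

lemma height_eq: "height {A, - A} = mat_height A"
proof -
  have "mat_height (- A) = mat_height A" by (simp add: mat_height_def)
  then show ?thesis unfolding height_def by auto
qed

lemma cmod_le_mat_height: "cmod (A $ i $ j) \<le> mat_height A"
proof -
  have "{cmod (A $ i $ j) | i j. True} = (\<lambda>(i, j). cmod (A $ i $ j)) ` UNIV" by auto
  then show ?thesis unfolding mat_height_def by (intro Max_ge) auto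
qed

lemma finite_quad_int_ring_le:
  assumes "d > 0"
  shows "finite {x \<in> quad_int_ring d. cmod x \<le> T}"
proof -
  have csq: "csqrt (- of_int d) = \<i> * of_real (sqrt (of_int d))"
    using assms by (intro csqrt_unique) (auto simp: power_mult_distrib simp flip: of_real_power)
  have pos: "sqrt (of_int d) \<ge> 1" using assms by simp
  have Im: "Im (omega d) \<ge> 1 / 2" and Re: "\<bar>Re (omega d)\<bar> \<le> 1"
    using pos by (auto simp: omega_def csq simp del: real_sqrt_ge_1_iff)
  have bound: "\<bar>of_int b\<bar> \<le> 2 * T \<and> \<bar>of_int a\<bar> \<le> 3 * T"
    if "cmod (of_int a + of_int b * omega d) \<le> T" for a b :: int
  proof -
    have "\<bar>of_int b * Im (omega d)\<bar> \<le> T"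
      using abs_Im_le_cmod[of "of_int a + of_int b * omega d"] that by simp
    moreover have "\<bar>of_int b\<bar> * (1/2) \<le> \<bar>of_int b\<bar> * Im (omega d)"
      using Im by (intro mult_left_mono) auto
    ultimately have b: "\<bar>of_int b :: real\<bar> \<le> 2 * T" using Im by (simp add: abs_mult)
    have "\<bar>of_int a + of_int b * Re (omega d)\<bar> \<le> T"
      using abs_Re_le_cmod[of "of_int a + of_int b * omega d"] that by simp
    moreover have "\<bar>of_int b * Re (omega d)\<bar> \<le> \<bar>of_int b\<bar> * 1"
      unfolding abs_mult using Re by (intro mult_left_mono) auto
    ultimately show ?thesis using b by linarith
  qed
  have "{x \<in> quad_int_ring d. cmod x \<le> T} \<subseteq>
      (\<lambda>(a, b). of_int a + of_int b * omega d) ` ({-\<lfloor>3*T\<rfloor>..\<lfloor>3*T\<rfloor>} \<times> {-\<lfloor>2*T\<rfloor>..\<lfloor>2*T\<rfloor>})"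
  proof
    fix x assume "x \<in> {x \<in> quad_int_ring d. cmod x \<le> T}"
    then obtain a b where x: "x = of_int a + of_int b * omega d" and "cmod x \<le> T"
      unfolding quad_int_ring_eq by blast
    then have "\<bar>b\<bar> \<le> \<lfloor>2*T\<rfloor>" "\<bar>a\<bar> \<le> \<lfloor>3*T\<rfloor>"
      using bound[of a b] by (simp_all add: le_floor_iff)
    then have "(a, b) \<in> {-\<lfloor>3*T\<rfloor>..\<lfloor>3*T\<rfloor>} \<times> {-\<lfloor>2*T\<rfloor>..\<lfloor>2*T\<rfloor>}" by auto
    then show "x \<in> (\<lambda>(a, b). of_int a + of_int b * omega d) `
        ({-\<lfloor>3*T\<rfloor>..\<lfloor>3*T\<rfloor>} \<times> {-\<lfloor>2*T\<rfloor>..\<lfloor>2*T\<rfloor>})"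
      using x by force
  qed
  then show ?thesis by (rule finite_subset) simp
qed

lemma finite_height_le:
  assumes "d > 0"
  shows "finite {A \<in> carrier (PSL2 d). height A \<le> T}"
proof -
  let ?F = "{x \<in> quad_int_ring d. cmod x \<le> T}"
  let ?m = "\<lambda>(a, b, c, e). vector [vector [a, b], vector [c, e]] :: complex^2^2"
  have fin: "finite ((\<lambda>A. {A, - A}) ` ?m ` (?F \<times> ?F \<times> ?F \<times> ?F))"
    using finite_quad_int_ring_le[OF assms] by simp
  have "{A \<in> carrier (PSL2 d). height A \<le> T} \<subseteq> (\<lambda>A. {A, - A}) ` ?m ` (?F \<times> ?F \<times> ?F \<times> ?F)"
  proof
    fix X assume "X \<in> {A \<in> carrier (PSL2 d). height A \<le> T}"
    then obtain A where X: "X = {A, - A}" and A: "A \<in> carrier (SL2 d)" and "mat_height A \<le> T"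
      unfolding carrier_PSL2 by (auto simp: height_eq)
    then have "A $ i $ j \<in> ?F" for i j
      using cmod_le_mat_height[of A i j] by (auto simp: SL2_simps)
    then have "(A$1$1, A$1$2, A$2$1, A$2$2) \<in> ?F \<times> ?F \<times> ?F \<times> ?F" by blast
    moreover have "A = ?m (A$1$1, A$1$2, A$2$1, A$2$2)"
      by (simp add: vec_eq_iff forall_2)
    ultimately show "X \<in> (\<lambda>A. {A, - A}) ` ?m ` (?F \<times> ?F \<times> ?F \<times> ?F)"
      unfolding X by blast
  qed
  then show ?thesis using fin by (rule finite_subset)
qed

end

theory Submission
  imports Defs
begin

text \<open>Write a matrix as \<open>(a, b; c, e)\<close> with \<open>a e - b c = 1\<close>. Distinct elements of \<open>O\<close> are at
  distance at least 1, so counting reduces to packing discs.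

  Upper bound: for a fixed first column with \<open>|a| \<le> |c|\<close>, the admissible \<open>e\<close> differ by multiples
  of \<open>c\<close>, so there are \<open>O(T^2 / |c|^2)\<close> completions. There are \<open>O(|c|^2)\<close> choices of \<open>a\<close> and
  \<open>O(T^2)\<close> choices of \<open>c\<close>. The case \<open>|c| \<le> |a|\<close> follows by exchanging the rows.

  Lower bound: if the norms of \<open>a\<close> and \<open>c\<close> are coprime integers, then \<open>(a, c)\<close> is a first column by
  Bezout, and reducing \<open>b\<close> modulo \<open>a\<close> keeps the height \<open>O(T)\<close>. No ideal theory is needed. To see
  that a positive proportion of columns qualifies, take \<open>a = 1 + M v\<close> and \<open>c = M u\<close> with \<open>M = Y!\<close>:
  a common prime \<open>p\<close> of the norms then exceeds \<open>Y\<close>, and the pairs lost to \<open>p\<close> form a proportion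
  \<open>O(1 / p^2)\<close> with a constant independent of \<open>Y\<close>, so the total loss is \<open>O(1 / Y)\<close>.\<close>

section \<open>The norm form of the ring\<close>

text \<open>This is the field norm \<open>z * cnj z\<close>. The floor only moves it to type
  \<open>int\<close>: on \<open>quad_int_ring d\<close> the squared modulus is already an integer
  (\<open>of_int_qnorm\<close>).\<close>

definition qnorm :: "complex \<Rightarrow> int" where
  "qnorm z = \<lfloor>(cmod z)\<^sup>2\<rfloor>"

lemma csqrt_neg_of_int:
  assumes "d > 0"
  shows "csqrt (- of_int d) = \<i> * of_real (sqrt (of_int d))"
  using assms by (intro csqrt_unique) (auto simp: power_mult_distrib simp flip: of_real_power)

lemma Im_omega_pos: "d > 0 \<Longrightarrow> Im (omega d) > 0"
  by (auto simp: omega_def csqrt_neg_of_int)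

text \<open>Trace and norm of \<open>omega d\<close> are -1 and (d + 1) / 4 if
  \<open>d mod 4 = 3\<close>, and 0 and d otherwise. Their integrality makes the squared modulus an
  integral binary quadratic form in the coordinates.\<close>

lemma omega_trace_norm:
  assumes "d > 0"
  obtains s n :: int where "cnj (omega d) = of_int s - omega d"
    "omega d * cnj (omega d) = of_int n"
proof (cases "d mod 4 = 3")
  case True
  then obtain k where k: "d = 4 * k + 3" by (metis mult_div_mod_eq)
  have om: "omega d = (- 1 + \<i> * of_real (sqrt (of_int d))) / 2"
    using True by (simp add: omega_def csqrt_neg_of_int assms)
  have sq: "complex_of_real (sqrt (of_int d)) * of_real (sqrt (of_int d)) = of_int d"
    using assms by (simp flip: of_real_mult)
  have "cnj (omega d) = of_int (- 1) - omega d"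
    by (simp add: om field_simps)
  moreover have "omega d * cnj (omega d) = (1 + of_int d) / 4"
    using sq by (simp add: om field_simps)
  then have "omega d * cnj (omega d) = of_int (k + 1)"
    by (simp add: k add_divide_distrib)
  ultimately show ?thesis by (rule that)
next
  case False
  then have om: "omega d = \<i> * of_real (sqrt (of_int d))"
    by (simp add: omega_def csqrt_neg_of_int assms)
  have sq: "complex_of_real (sqrt (of_int d)) * of_real (sqrt (of_int d)) = of_int d"
    using assms by (simp flip: of_real_mult)
  have "cnj (omega d) = of_int 0 - omega d" "omega d * cnj (omega d) = of_int d"
    using sq by (simp_all add: om algebra_simps)
  then show ?thesis by (rule that)
qed

lemma cmod_square_form:
  assumes "d > 0"
  shows "\<exists>s n :: int. \<forall>x y. (cmod (of_int x + of_int y * omega d))\<^sup>2 = of_int (x\<^sup>2 + s * x * y + n * y\<^sup>2)"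
proof -
  obtain s n :: int where s: "cnj (omega d) = of_int s - omega d"
    and n: "omega d * cnj (omega d) = of_int n"
    using omega_trace_norm[OF assms] .
  have "(cmod (of_int x + of_int y * omega d))\<^sup>2 = of_int (x\<^sup>2 + s * x * y + n * y\<^sup>2)" for x y
  proof -
    have "complex_of_real ((cmod (of_int x + of_int y * omega d))\<^sup>2)
        = of_int (x\<^sup>2) + of_int (x * y) * (omega d + cnj (omega d))
          + of_int (y\<^sup>2) * (omega d * cnj (omega d))"
      by (subst complex_norm_square) (simp add: algebra_simps power2_eq_square)
    also have "\<dots> = complex_of_real (of_int (x\<^sup>2 + s * x * y + n * y\<^sup>2))"
      unfolding n by (simp add: s)
    finally show ?thesis unfolding of_real_eq_iff .
  qed
  then show ?thesis by blast
qed

lemma qnorm_form: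
  assumes "d > 0"
  shows "\<exists>s n. \<forall>x y. qnorm (of_int x + of_int y * omega d) = x\<^sup>2 + s * x * y + n * y\<^sup>2"
proof -
  obtain s n where *: "\<And>x y. (cmod (of_int x + of_int y * omega d))\<^sup>2 = of_int (x\<^sup>2 + s * x * y + n * y\<^sup>2)"
    using cmod_square_form[OF assms] by blast
  have "qnorm (of_int x + of_int y * omega d) = x\<^sup>2 + s * x * y + n * y\<^sup>2" for x y
    unfolding qnorm_def * by (rule floor_of_int)
  then show ?thesis by blast
qed

lemma of_int_in_quad_int_ring: "of_int k \<in> quad_int_ring d"
  unfolding quad_int_ring_eq by (rule CollectI) (rule exI[of _ k], rule exI[of _ 0], simp)

lemma diff_in_quad_int_ring:
  "x \<in> quad_int_ring d \<Longrightarrow> y \<in> quad_int_ring d \<Longrightarrow> x - y \<in> quad_int_ring d"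
  using quad_int_ring_closed(1)[OF _ quad_int_ring_closed(2)] by fastforce

lemma cnj_in_quad_int_ring:
  assumes "d > 0" "z \<in> quad_int_ring d"
  shows "cnj z \<in> quad_int_ring d"
proof -
  obtain s :: int where s: "cnj (omega d) = of_int s - omega d"
    using omega_trace_norm[OF assms(1)] by metis
  obtain x y where z: "z = of_int x + of_int y * omega d"
    using assms(2) unfolding quad_int_ring_eq by blast
  have "cnj z = of_int (x + y * s) + of_int (- y) * omega d"
    by (simp add: z s algebra_simps)
  then show ?thesis unfolding quad_int_ring_eq by blast
qed

lemma of_int_qnorm:
  assumes "d > 0" "z \<in> quad_int_ring d"
  shows "of_int (qnorm z) = (cmod z)\<^sup>2"
proof -
  obtain s n where *: "\<And>x y. (cmod (of_int x + of_int y * omega d))\<^sup>2 = of_int (x\<^sup>2 + s * x * y + n * y\<^sup>2)"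
    using cmod_square_form[OF assms(1)] by blast
  obtain x y where "z = of_int x + of_int y * omega d"
    using assms(2) unfolding quad_int_ring_eq by blast
  then show ?thesis unfolding qnorm_def by (simp only: * floor_of_int)
qed

lemma qnorm_mult_of_int:
  assumes "d > 0" "z \<in> quad_int_ring d"
  shows "qnorm (of_int m * z) = m\<^sup>2 * qnorm z"
proof -
  have "real_of_int (qnorm (of_int m * z)) = of_int (m\<^sup>2 * qnorm z)"
    using assms by (simp add: of_int_qnorm[OF assms(1)] quad_int_ring_closed
        of_int_in_quad_int_ring norm_mult power_mult_distrib)
  then show ?thesis by linarith
qed

lemma qnorm_pos:
  assumes "d > 0" "z \<in> quad_int_ring d" "z \<noteq> 0"
  shows "qnorm z > 0"
proof -
  have "real_of_int (qnorm z) > 0" using assms by (simp add: of_int_qnorm[OF assms(1)])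
  then show ?thesis by simp
qed

text \<open>A positive integer divisible by \<open>p\<close> is at least \<open>p\<close>. Applied
  to differences, this is the source of every separation below: distance 1 for distinct ring
  elements, and distance \<open>sqrt p\<close> on subgroups whose norms are divisible by
  \<open>p\<close>.\<close>

lemma sqrt_le_cmod:
  assumes "d > 0" "z \<in> quad_int_ring d" "z \<noteq> 0" "p dvd qnorm z"
  shows "sqrt (of_int p) \<le> cmod z"
proof (rule real_le_lsqrt)
  have "p \<le> qnorm z" using qnorm_pos[OF assms(1-3)] assms(4) zdvd_imp_le by blast
  then show "of_int p \<le> (cmod z)\<^sup>2"
    unfolding of_int_qnorm[OF assms(1,2), symmetric] by simp
qed auto

lemma one_le_cmod:
  assumes "d > 0" "z \<in> quad_int_ring d" "z \<noteq> 0"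
  shows "1 \<le> cmod z"
  using sqrt_le_cmod[OF assms, of 1] by simp

text \<open>Needed for \<open>m = fact Y\<close>: no prime up to \<open>Y\<close> can divide the
  norm of an element congruent to 1 modulo \<open>m\<close>.\<close>

lemma qnorm_one_add_mult:
  assumes "d > 0" "v \<in> quad_int_ring d"
  obtains k where "qnorm (1 + of_int m * v) = 1 + m * k"
proof -
  obtain s n where q: "\<And>x y. qnorm (of_int x + of_int y * omega d) = x\<^sup>2 + s * x * y + n * y\<^sup>2"
    using qnorm_form[OF assms(1)] by blast
  obtain x y where v: "v = of_int x + of_int y * omega d"
    using assms(2) unfolding quad_int_ring_eq by blast
  have "1 + of_int m * v = of_int (1 + m * x) + of_int (m * y) * omega d"
    by (simp add: v algebra_simps)
  then have "qnorm (1 + of_int m * v) = (1 + m * x)\<^sup>2 + s * (1 + m * x) * (m * y) + n * (m * y)\<^sup>2"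
    by (simp only: q)
  also have "\<dots> = 1 + m * (2 * x + m * x\<^sup>2 + s * (1 + m * x) * y + n * m * y\<^sup>2)"
    by (simp add: power2_eq_square algebra_simps)
  finally show ?thesis by (rule that)
qed

text \<open>The zeros modulo \<open>p\<close> of a binary quadratic form lie on at most two lines. If
  \<open>(x0, y0)\<close> is a zero with \<open>y0\<close> invertible, these are the lines through \<open>(x0, y0)\<close> and through
  the other root of the form.\<close>

lemma prime_dvd_qnorm_two_subgroups:
  fixes p :: int
  assumes "d > 0" "prime p"
  obtains L1 L2 where "{z \<in> quad_int_ring d. p dvd qnorm z} = L1 \<union> L2"
    "\<And>x y. x \<in> L1 \<Longrightarrow> y \<in> L1 \<Longrightarrow> x - y \<in> L1" "\<And>x y. x \<in> L2 \<Longrightarrow> y \<in> L2 \<Longrightarrow> x - y \<in> L2"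
proof -
  let ?f = "\<lambda>x y. of_int x + of_int y * omega d"
  let ?Z = "{z \<in> quad_int_ring d. p dvd qnorm z}"
  have f: "?f x y \<in> quad_int_ring d" for x y unfolding quad_int_ring_eq by blast
  have fdiff: "?f x y - ?f x' y' = ?f (x - x') (y - y')" for x y x' y'
    by (simp add: algebra_simps)
  obtain s n where q: "\<And>x y. qnorm (?f x y) = x\<^sup>2 + s * x * y + n * y\<^sup>2"
    using qnorm_form[OF assms(1)] by blast
  show ?thesis
  proof (cases "\<exists>x0 y0. p dvd qnorm (?f x0 y0) \<and> \<not> p dvd y0")
    case True
    then obtain x0 y0 where "p dvd qnorm (?f x0 y0)" "\<not> p dvd y0" by blast
    then have 0: "p dvd x0\<^sup>2 + s * x0 * y0 + n * y0\<^sup>2" "\<not> p dvd y0" by (simp_all only: q not_False_eq_True)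
    define L where "L g = {?f x y | x y. p dvd (g x y :: int)}" for g :: "int \<Rightarrow> int \<Rightarrow> int"
    define g1 where "g1 x y = x * y0 - x0 * y" for x y
    define g2 where "g2 x y = x * y0 + x0 * y + s * y * y0" for x y
    \<comment> \<open>\<open>g1\<close> vanishes at \<open>(x0, y0)\<close> and \<open>g2\<close> at
      the other root \<open>(- x0 - s * y0, y0)\<close>. Subtracting \<open>y^2\<close> times the
      value at \<open>(x0, y0)\<close> cancels the \<open>n\<close> terms, and what remains is their
      product.\<close>
    have fac: "y0\<^sup>2 * (x\<^sup>2 + s * x * y + n * y\<^sup>2)
        = g1 x y * g2 x y + y\<^sup>2 * (x0\<^sup>2 + s * x0 * y0 + n * y0\<^sup>2)" for x y
      by (simp add: g1_def g2_def power2_eq_square algebra_simps)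
    have iff: "p dvd qnorm (?f x y) \<longleftrightarrow> p dvd g1 x y \<or> p dvd g2 x y" for x y
    proof -
      have "p dvd qnorm (?f x y) \<longleftrightarrow> p dvd y0\<^sup>2 * qnorm (?f x y)"
        using assms(2) 0(2) by (simp add: prime_dvd_mult_iff prime_dvd_power_iff)
      also have "\<dots> \<longleftrightarrow> p dvd g1 x y * g2 x y"
        unfolding q fac using 0(1) by (simp add: dvd_add_left_iff)
      finally show ?thesis using assms(2) by (simp add: prime_dvd_mult_iff)
    qed
    have "?Z = L g1 \<union> L g2"
    proof (intro equalityI subsetI)
      fix z assume "z \<in> ?Z"
      moreover from this obtain x y where "z = ?f x y" unfolding quad_int_ring_eq by blast
      ultimately show "z \<in> L g1 \<union> L g2" using iff[of x y] unfolding L_def by blast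
    next
      fix z assume "z \<in> L g1 \<union> L g2"
      then obtain x y where "z = ?f x y" "p dvd g1 x y \<or> p dvd g2 x y" unfolding L_def by blast
      then show "z \<in> ?Z" using iff[of x y] f by blast
    qed
    moreover have "z - w \<in> L g" if zw: "z \<in> L g" "w \<in> L g"
      and g: "\<And>x y x' y'. g (x - x') (y - y') = g x y - g x' y'" for z w g
    proof -
      obtain x y x' y' where "z = ?f x y" "w = ?f x' y'" "p dvd g x y" "p dvd g x' y'"
        using zw unfolding L_def by blast
      then have "z - w = ?f (x - x') (y - y')" "p dvd g (x - x') (y - y')"
        using fdiff g by auto
      then show ?thesis unfolding L_def by blast
    qed
    moreover have "g1 (x - x') (y - y') = g1 x y - g1 x' y'"
      "g2 (x - x') (y - y') = g2 x y - g2 x' y'" for x y x' y'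
      by (simp_all add: g1_def g2_def algebra_simps)
    ultimately show ?thesis by (intro that[of "L g1" "L g2"]) auto
  next
    case False
    \<comment> \<open>Here every zero modulo \<open>p\<close> has both coordinates divisible by
      \<open>p\<close>, so the zero set is itself closed under differences and serves as both
      \<open>L1\<close> and \<open>L2\<close>.\<close>
    have dvd: "p dvd x \<and> p dvd y" if "p dvd qnorm (?f x y)" for x y
    proof -
      have y: "p dvd y" using False that by blast
      then have "p dvd s * x * y + n * y\<^sup>2" by (simp add: power2_eq_square)
      with that have "p dvd x\<^sup>2" unfolding q by (metis add.assoc dvd_add_left_iff)
      then show ?thesis using y prime_dvd_power[OF assms(2)] by blast
    qed
    have "z - w \<in> ?Z" if zw: "z \<in> ?Z" "w \<in> ?Z" for z w
    proof -
      from zw obtain x y x' y' where z: "z = ?f x y" and w: "w = ?f x' y'"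
        unfolding quad_int_ring_eq by blast
      from zw have "p dvd qnorm (?f x y)" "p dvd qnorm (?f x' y')" unfolding z w by blast+
      then have "p dvd x - x'" "p dvd y - y'"
        using dvd[of x y] dvd[of x' y'] by (blast intro: dvd_diff)+
      then have "p dvd qnorm (?f (x - x') (y - y'))" unfolding q by (simp add: power2_eq_square)
      then show ?thesis using fdiff[of x y x' y'] f[of "x - x'" "y - y'"] unfolding z w by (simp only: mem_Collect_eq)
    qed
    from that[OF Un_absorb[symmetric] this this] show ?thesis .
  qed
qed

section \<open>Packing and covering in the plane\<close>

text \<open>In a grid of mesh \<open>\<delta> / 2\<close>, two points of one cell differ by less
  than \<open>\<delta> / 2\<close> in each coordinate, hence by less than \<open>\<delta>\<close>.
  So each cell holds at most one point of \<open>S\<close>, and it remains to count cells.\<close>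

lemma separated_card_le:
  assumes "\<delta> > 0" "R \<ge> 0"
    and sep: "\<And>x y. x \<in> S \<Longrightarrow> y \<in> S \<Longrightarrow> x \<noteq> y \<Longrightarrow> \<delta> \<le> cmod (x - y)"
    and bd: "\<And>x. x \<in> S \<Longrightarrow> cmod x \<le> R"
  shows "finite S" "real (card S) \<le> (4 * R / \<delta> + 2)\<^sup>2"
proof -
  let ?g = "\<lambda>z. (\<lfloor>2 * Re z / \<delta>\<rfloor>, \<lfloor>2 * Im z / \<delta>\<rfloor>)"
  let ?I = "{\<lfloor>- (2 * R / \<delta>)\<rfloor>..\<lfloor>2 * R / \<delta>\<rfloor>}"
  have close: "\<bar>a - b\<bar> < \<delta> / 2" if "\<lfloor>2 * a / \<delta>\<rfloor> = \<lfloor>2 * b / \<delta>\<rfloor>" for a b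
  proof -
    have "\<bar>2 * a / \<delta> - 2 * b / \<delta>\<bar> < 1" using that by linarith
    moreover have "2 * a / \<delta> - 2 * b / \<delta> = 2 * (a - b) / \<delta>"
      by (simp add: diff_divide_distrib right_diff_distrib)
    ultimately have "\<bar>2 * (a - b)\<bar> / \<delta> < 1" using assms(1) by (simp only: abs_divide abs_of_pos)
    then have "\<bar>2 * (a - b)\<bar> < \<delta>" using assms(1) by (simp only: divide_less_eq_1_pos)
    then show ?thesis by (simp only: abs_mult) simp
  qed
  have inj: "inj_on ?g S"
  proof (rule inj_onI, rule ccontr)
    fix x y assume xy: "x \<in> S" "y \<in> S" "?g x = ?g y" "x \<noteq> y"
    have "cmod (x - y) \<le> \<bar>Re (x - y)\<bar> + \<bar>Im (x - y)\<bar>" by (rule cmod_le)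
    also have "\<dots> < \<delta>" using close[of "Re x" "Re y"] close[of "Im x" "Im y"] xy by simp
    finally show False using sep[OF xy(1,2,4)] by simp
  qed
  have I: "\<lfloor>2 * a / \<delta>\<rfloor> \<in> ?I" if "\<bar>a\<bar> \<le> R" for a
  proof -
    have "2 * a / \<delta> \<le> 2 * R / \<delta>" "- (2 * R / \<delta>) \<le> 2 * a / \<delta>"
      using that assms(1) by (simp_all add: divide_right_mono field_simps)
    then show ?thesis using floor_mono by (metis atLeastAtMost_iff)
  qed
  have img: "?g ` S \<subseteq> ?I \<times> ?I"
  proof
    fix w assume "w \<in> ?g ` S"
    then obtain z where z: "z \<in> S" "w = ?g z" by blast
    have "\<bar>Re z\<bar> \<le> R" "\<bar>Im z\<bar> \<le> R"
      using abs_Re_le_cmod[of z] abs_Im_le_cmod[of z] bd[OF z(1)] by linarith+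
    then show "w \<in> ?I \<times> ?I" using I z(2) by blast
  qed
  \<comment> \<open>With r = 2 R / \<open>\<delta>\<close> the interval has floor r + ceiling r + 1
    elements, which is at most 2 r + 2.\<close>
  have cI: "real (card ?I) \<le> 4 * R / \<delta> + 2"
  proof -
    have "0 \<le> 2 * R / \<delta>" using assms by simp
    then show ?thesis by (simp add: of_nat_nat) linarith
  qed
  show "finite S" using inj img by (meson finite_SigmaI finite_atLeastAtMost_int inj_on_finite)
  have "card S \<le> card (?I \<times> ?I)" using inj img by (intro card_inj_on_le) auto
  then have "real (card S) \<le> real (card ?I) * real (card ?I)"
    unfolding card_cartesian_product of_nat_mult[symmetric] of_nat_le_iff .
  also have "\<dots> \<le> (4 * R / \<delta> + 2) * (4 * R / \<delta> + 2)"
    using cI assms by (intro mult_mono) auto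
  finally show "real (card S) \<le> (4 * R / \<delta> + 2)\<^sup>2" by (simp add: power2_eq_square)
qed

text \<open>When \<open>\<delta> \<le> R\<close> the additive 2 is absorbed, as 4 r + 2 is at most 6
  r for r at least 1. This is the origin of every factor 36 below.\<close>

lemma separated_card_le':
  assumes "\<delta> > 0" "\<delta> \<le> R"
    and "\<And>x y. x \<in> S \<Longrightarrow> y \<in> S \<Longrightarrow> x \<noteq> y \<Longrightarrow> \<delta> \<le> cmod (x - y)"
    and "\<And>x. x \<in> S \<Longrightarrow> cmod x \<le> R"
  shows "real (card S) \<le> 36 * R\<^sup>2 / \<delta>\<^sup>2"
proof -
  have "real (card S) \<le> (4 * R / \<delta> + 2)\<^sup>2"
    using assms by (intro separated_card_le) auto
  also have "\<dots> \<le> (6 * (R / \<delta>))\<^sup>2"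
  proof (rule power_mono)
    have "1 \<le> R / \<delta>" using assms by simp
    then show "4 * R / \<delta> + 2 \<le> 6 * (R / \<delta>)" by linarith
  qed (use assms in auto)
  finally show ?thesis by (simp add: power_mult_distrib power_divide)
qed

lemma card_quad_int_ring_le:
  assumes "d > 0" "R \<ge> 1"
  shows "real (card {z \<in> quad_int_ring d. cmod z \<le> R}) \<le> 36 * R\<^sup>2"
proof -
  let ?S = "{z \<in> quad_int_ring d. cmod z \<le> R}"
  have "1 \<le> cmod (x - y)" if "x \<in> ?S" "y \<in> ?S" "x \<noteq> y" for x y
    using that by (intro one_le_cmod[OF assms(1)] diff_in_quad_int_ring) auto
  then have "real (card ?S) \<le> 36 * R\<^sup>2 / 1\<^sup>2"
    using assms(2) by (intro separated_card_le') auto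
  then show ?thesis by simp
qed

text \<open>Elements with both coordinates at most k = floor (R / W) in absolute value, where W = 1
  + |omega|, lie in the disc. There are 2 k + 1 values per coordinate, at least k + 1 and hence at
  least R / W.\<close>

lemma card_quad_int_ring_ge:
  assumes "d > 0" "R \<ge> 0"
  shows "(R / (1 + cmod (omega d)))\<^sup>2 \<le> real (card {z \<in> quad_int_ring d. cmod z \<le> R})"
proof -
  define W where "W = 1 + cmod (omega d)"
  define k where "k = \<lfloor>R / W\<rfloor>"
  have W: "W > 0" by (simp add: W_def add_pos_nonneg)
  have k0: "k \<ge> 0" using W assms by (simp add: k_def)
  let ?f = "\<lambda>(x, y). of_int x + of_int y * omega d"
  have "inj_on ?f ({-k..k} \<times> {-k..k})"
    using Im_omega_pos[OF assms(1)] by (auto intro!: inj_onI simp: complex_eq_iff)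
  moreover have "?f ` ({-k..k} \<times> {-k..k}) \<subseteq> {z \<in> quad_int_ring d. cmod z \<le> R}"
  proof (clarify, rule conjI)
    fix x y assume xy: "x \<in> {-k..k}" "y \<in> {-k..k}"
    show "of_int x + of_int y * omega d \<in> quad_int_ring d" unfolding quad_int_ring_eq by blast
    have "\<bar>x\<bar> \<le> k" "\<bar>y\<bar> \<le> k" using xy by auto
    then have "\<bar>real_of_int x\<bar> \<le> of_int k" "\<bar>real_of_int y\<bar> \<le> of_int k" by linarith+
    moreover have "cmod (of_int x + of_int y * omega d) \<le> \<bar>of_int x\<bar> + \<bar>of_int y\<bar> * cmod (omega d)"
      by (metis norm_triangle_ineq norm_mult norm_of_int)
    ultimately have "cmod (of_int x + of_int y * omega d) \<le> of_int k + of_int k * cmod (omega d)"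
      by (smt (verit) mult_right_mono norm_ge_zero)
    also have "\<dots> = of_int k * W" by (simp add: W_def algebra_simps)
    also have "\<dots> \<le> R / W * W" using W by (intro mult_right_mono) (auto simp: k_def)
    finally show "cmod (of_int x + of_int y * omega d) \<le> R" using W by simp
  qed
  ultimately have "card ({-k..k} \<times> {-k..k}) \<le> card {z \<in> quad_int_ring d. cmod z \<le> R}"
    using finite_quad_int_ring_le[OF assms(1)] by (rule card_inj_on_le)
  then have "real (card {-k..k}) * real (card {-k..k}) \<le> real (card {z \<in> quad_int_ring d. cmod z \<le> R})"
    unfolding card_cartesian_product of_nat_mult[symmetric] of_nat_le_iff .
  moreover have "R / W \<le> of_int k + 1" unfolding k_def by linarith
  then have "R / W \<le> real (card {-k..k})"
    using k0 by simp
  then have "R / W * (R / W) \<le> real (card {-k..k}) * real (card {-k..k})"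
    using W assms by (intro mult_mono) auto
  ultimately show ?thesis by (simp add: W_def power2_eq_square)
qed

text \<open>Both coordinates with respect to 1 and \<open>omega d\<close> are rounded down. This
  acts as a division with remainder: the remainder may exceed the divisor, but only by a factor
  depending on \<open>d\<close>.\<close>

lemma quad_int_ring_covering:
  assumes "d > 0"
  obtains t where "t \<in> quad_int_ring d" "cmod (z - t) \<le> 1 + cmod (omega d)"
proof -
  define \<beta> where "\<beta> = Im z / Im (omega d)"
  define \<alpha> where "\<alpha> = Re z - \<beta> * Re (omega d)"
  define t where "t = of_int \<lfloor>\<alpha>\<rfloor> + of_int \<lfloor>\<beta>\<rfloor> * omega d"
  have "z = of_real \<alpha> + of_real \<beta> * omega d"
    using Im_omega_pos[OF assms] by (simp add: complex_eq_iff \<alpha>_def \<beta>_def)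
  then have "z - t = of_real (frac \<alpha>) + of_real (frac \<beta>) * omega d"
    by (simp add: t_def frac_def algebra_simps)
  then have "cmod (z - t) \<le> \<bar>frac \<alpha>\<bar> + \<bar>frac \<beta>\<bar> * cmod (omega d)"
    by (metis norm_triangle_ineq norm_mult norm_of_real)
  also have "\<dots> \<le> 1 + 1 * cmod (omega d)"
    using frac_lt_1[of \<alpha>] frac_lt_1[of \<beta>] by (intro add_mono mult_right_mono) auto
  finally have "cmod (z - t) \<le> 1 + cmod (omega d)" by simp
  moreover have "t \<in> quad_int_ring d" unfolding quad_int_ring_eq t_def by blast
  ultimately show ?thesis using that by blast
qed

section \<open>The upper bound\<close>

lemma mat_height_le_iff: "mat_height A \<le> H \<longleftrightarrow> (\<forall>i j. cmod (A $ i $ j) \<le> H)"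
proof -
  have "{cmod (A $ i $ j) | i j. True} = (\<lambda>(i, j). cmod (A $ i $ j)) ` UNIV" by auto
  then show ?thesis unfolding mat_height_def by (subst Max_le_iff) auto
qed

text \<open>Since \<open>c\<close> is nonzero, \<open>e\<close> determines \<open>b\<close>.
  Distinct admissible \<open>e\<close> differ by a nonzero multiple of \<open>c\<close>, so they
  form a set separated by \<open>cmod c\<close> in the disc of radius \<open>T\<close>.\<close>

lemma card_completions_le:
  assumes "d > 0" "a \<in> quad_int_ring d" "c \<in> quad_int_ring d" "c \<noteq> 0" "cmod c \<le> T"
  defines "F \<equiv> {(b, e). b \<in> quad_int_ring d \<and> e \<in> quad_int_ring d \<and> cmod b \<le> T \<and> cmod e \<le> T
    \<and> a * e - b * c = 1}"
  shows "finite F" "real (card F) \<le> 36 * T\<^sup>2 / (cmod c)\<^sup>2"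
proof -
  have sep: "cmod c \<le> cmod (e - e')"
    if "(b, e) \<in> F" "(b', e') \<in> F" "e \<noteq> e'" for b e b' e'
  proof -
    have 1: "a * e - b * c = 1" "a * e' - b' * c = 1" using that by (auto simp: F_def)
    \<comment> \<open>Multiplying \<open>e - e'\<close> by the determinant, which is 1, exhibits the
      quotient by \<open>c\<close> explicitly, without inverting \<open>a\<close> modulo
      \<open>c\<close>.\<close>
    define t where "t = e * (b - b') - b * (e - e')"
    have "e - e' = (a * e - b * c) * (e - e')" by (simp add: 1)
    also have "\<dots> = e * (a * e - a * e') - b * c * (e - e')" by (simp add: algebra_simps)
    also have "a * e - a * e' = (b - b') * c" using 1 by (simp add: algebra_simps)
    also have "e * ((b - b') * c) - b * c * (e - e') = t * c" by (simp add: t_def algebra_simps)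
    finally have e: "e - e' = t * c" .
    have "t \<in> quad_int_ring d"
      using that unfolding t_def F_def by (auto intro!: diff_in_quad_int_ring quad_int_ring_closed(3))
    moreover have "t \<noteq> 0" using e that(3) by auto
    ultimately have "1 \<le> cmod t" by (rule one_le_cmod[OF assms(1)])
    then have "1 * cmod c \<le> cmod t * cmod c" by (intro mult_right_mono) auto
    then show ?thesis unfolding e by (simp add: norm_mult)
  qed
  have inj: "inj_on snd F"
  proof (rule inj_onI)
    fix x y assume xy: "x \<in> F" "y \<in> F" "snd x = snd y"
    obtain b e b' where "x = (b, e)" "y = (b', e)" using xy(3) by (metis prod.collapse)
    then have "a * e - b * c = 1" "a * e - b' * c = 1" using xy by (auto simp: F_def)
    then have "b * c = b' * c" by (simp add: algebra_simps)
    then show "x = y" using \<open>x = _\<close> \<open>y = _\<close> assms(4) by simp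
  qed
  have bd: "cmod e \<le> T" if "e \<in> snd ` F" for e using that by (auto simp: F_def)
  have sep': "cmod c \<le> cmod (e - e')" if "e \<in> snd ` F" "e' \<in> snd ` F" "e \<noteq> e'" for e e'
    using sep that by fastforce
  have c: "cmod c > 0" "T \<ge> 0" using assms(4,5) norm_ge_zero[of c] by (simp, linarith)
  have "finite (snd ` F)" by (rule separated_card_le(1)[OF c sep' bd])
  then show "finite F" using inj finite_imageD by blast
  show "real (card F) \<le> 36 * T\<^sup>2 / (cmod c)\<^sup>2"
    unfolding card_image[OF inj, symmetric]
    by (rule separated_card_le'[OF c(1) assms(5) sep' bd])
qed

text \<open>Every class modulo sign comes from some quadruple, which suffices for an upper bound;
  the two signs are simply counted separately on the right.\<close>

lemma count_height_le_card:
  assumes "d > 0"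
  defines "B \<equiv> \<lambda>T. {z \<in> quad_int_ring d. cmod z \<le> T}"
  shows "count_height d T \<le> card {(a, b, c, e) \<in> B T \<times> B T \<times> B T \<times> B T. a * e - b * c = 1}"
    (is "_ \<le> card ?Q")
proof -
  define m :: "complex \<times> complex \<times> complex \<times> complex \<Rightarrow> complex^2^2"
    where "m = (\<lambda>(a, b, c, e). vector [vector [a, b], vector [c, e]])"
  have "finite (B T)" unfolding B_def by (rule finite_quad_int_ring_le[OF assms(1)])
  then have fin: "finite ?Q" by (auto intro: finite_subset[of _ "B T \<times> B T \<times> B T \<times> B T"])
  have "{A \<in> carrier (PSL2 d). height A \<le> T} \<subseteq> (\<lambda>q. {m q, - m q}) ` ?Q"
  proof
    fix X assume "X \<in> {A \<in> carrier (PSL2 d). height A \<le> T}"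
    then obtain A where X: "X = {A, - A}" and A: "A \<in> carrier (SL2 d)" "mat_height A \<le> T"
      unfolding carrier_PSL2 by (auto simp: height_eq)
    then have "A $ i $ j \<in> B T" for i j
      by (auto simp: SL2_simps B_def mat_height_le_iff)
    moreover have "A$1$1 * A$2$2 - A$1$2 * A$2$1 = 1" using A by (simp add: SL2_simps det_2)
    ultimately have "(A$1$1, A$1$2, A$2$1, A$2$2) \<in> ?Q" by simp
    moreover have "A = m (A$1$1, A$1$2, A$2$1, A$2$2)"
      by (simp add: m_def vec_eq_iff forall_2)
    ultimately show "X \<in> (\<lambda>q. {m q, - m q}) ` ?Q" 
      unfolding X by (intro image_eqI[of _ _ "(A$1$1, A$1$2, A$2$1, A$2$2)"]) simp_all
  qed
  then show ?thesis unfolding count_height_def using fin by (rule surj_card_le[rotated])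
qed

text \<open>The constant is 2 * 36^3: one factor 36 for each of \<open>c\<close>, \<open>a\<close>
  and the completions \<open>(b, e)\<close>, and the 2 for exchanging the rows. The powers of
  \<open>cmod c\<close> from the last two counts cancel.\<close>

lemma count_height_upper:
  assumes "d > 0" "T \<ge> 1"
  shows "real (count_height d T) \<le> 93312 * T ^ 4"
proof -
  define B where "B T = {z \<in> quad_int_ring d. cmod z \<le> T}" for T
  define F where "F a c = {(b, e). b \<in> quad_int_ring d \<and> e \<in> quad_int_ring d
    \<and> cmod b \<le> T \<and> cmod e \<le> T \<and> a * e - b * c = 1}" for a c
  define Q where "Q = {(a, b, c, e) \<in> B T \<times> B T \<times> B T \<times> B T. a * e - b * c = 1}"
  define Q1 where "Q1 = (SIGMA c:B T - {0}. SIGMA a:B (cmod c). F a c)"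
  \<comment> \<open>\<open>Q1\<close> lists \<open>c\<close> first because the range of
    \<open>a\<close> depends on it. \<open>?h\<close> exchanges the rows and negates the second
    column, which keeps the determinant, and covers the matrices with
    \<open>cmod a > cmod c\<close>.\<close>
  let ?g = "\<lambda>(c, a, b, e). (a, b, c, e)" and ?h = "\<lambda>(c, a, b, e). (c, - e, a, - b)"
  have finB: "finite (B R)" for R
    unfolding B_def by (rule finite_quad_int_ring_le[OF assms(1)])
  have F: "finite (F a c)" "real (card (F a c)) \<le> 36 * T\<^sup>2 / (cmod c)\<^sup>2"
    if "c \<in> B T - {0}" "a \<in> B (cmod c)" for a c
    using that card_completions_le[OF assms(1), of a c T] unfolding B_def F_def by auto
  have c1: "1 \<le> cmod c" if "c \<in> B T - {0}" for c
    using that one_le_cmod[OF assms(1)] by (auto simp: B_def)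
  have finQ1: "finite Q1" unfolding Q1_def using finB F(1) by (intro finite_SigmaI) auto
  have inner: "real (card (SIGMA a:B (cmod c). F a c)) \<le> 1296 * T\<^sup>2" if c: "c \<in> B T - {0}" for c
  proof -
    have "real (card (SIGMA a:B (cmod c). F a c)) = (\<Sum>a\<in>B (cmod c). real (card (F a c)))"
      using finB F(1) c by (subst card_SigmaI) auto
    also have "\<dots> \<le> real (card (B (cmod c))) * (36 * T\<^sup>2 / (cmod c)\<^sup>2)"
      using F(2) c by (intro sum_bounded_above) auto
    also have "\<dots> \<le> (36 * (cmod c)\<^sup>2) * (36 * T\<^sup>2 / (cmod c)\<^sup>2)"
      unfolding B_def using c1[OF c] by (intro mult_right_mono card_quad_int_ring_le assms) auto
    also have "\<dots> = 1296 * T\<^sup>2" using c1[OF c] by (auto simp: field_simps)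
    finally show ?thesis .
  qed
  have "real (card Q1) = (\<Sum>c\<in>B T - {0}. real (card (SIGMA a:B (cmod c). F a c)))"
    unfolding Q1_def using finB F(1) by (subst card_SigmaI) (auto intro!: finite_SigmaI)
  also have "\<dots> \<le> real (card (B T - {0})) * (1296 * T\<^sup>2)"
    using inner by (intro sum_bounded_above) auto
  also have "\<dots> \<le> (36 * T\<^sup>2) * (1296 * T\<^sup>2)"
  proof (rule mult_right_mono)
    have "real (card (B T - {0})) \<le> real (card (B T))" using finB by (simp add: card_mono)
    also have "\<dots> \<le> 36 * T\<^sup>2" unfolding B_def by (rule card_quad_int_ring_le[OF assms])
    finally show "real (card (B T - {0})) \<le> 36 * T\<^sup>2" .
  qed simp
  finally have Q1: "real (card Q1) \<le> 46656 * T ^ 4" by (simp add: power_def)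
  have "Q \<subseteq> ?g ` Q1 \<union> ?h ` Q1"
  proof
    fix q assume q: "q \<in> Q"
    obtain a b c e where q': "q = (a, b, c, e)" by (metis prod.collapse)
    have B: "a \<in> B T" "b \<in> B T" "c \<in> B T" "e \<in> B T" "a * e - b * c = 1"
      using q by (auto simp: Q_def q')
    show "q \<in> ?g ` Q1 \<union> ?h ` Q1"
    proof (cases "cmod a \<le> cmod c")
      case True
      then have "c \<noteq> 0" using B(5) by auto
      then have "(c, a, b, e) \<in> Q1" using B True unfolding Q1_def F_def B_def by auto
      then show ?thesis by (intro UnI1 image_eqI[of _ _ "(c, a, b, e)"]) (simp_all add: q')
    next
      case False
      then have "a \<noteq> 0" by auto
      then have "(a, c, - e, - b) \<in> Q1"
        using B False unfolding Q1_def F_def B_def by (auto simp: algebra_simps quad_int_ring_closed)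
      then show ?thesis by (intro UnI2 image_eqI[of _ _ "(a, c, - e, - b)"]) (simp_all add: q')
    qed
  qed
  then have "card Q \<le> card (?g ` Q1 \<union> ?h ` Q1)" using finQ1 by (intro card_mono) auto
  also have "\<dots> \<le> card Q1 + card Q1"
    using card_Un_le card_image_le[OF finQ1] by (meson add_mono le_trans)
  finally have "card Q \<le> 2 * card Q1" by simp
  moreover have "count_height d T \<le> card Q"
    using count_height_le_card[OF assms(1), of T] unfolding Q_def B_def .
  ultimately show ?thesis using Q1 by linarith
qed

section \<open>Completing a first column with coprime norms\<close>

text \<open>A Bezout relation between the norms \<open>a * cnj a\<close> and
  \<open>c * cnj c\<close> is already a determinant equal to 1. Subtracting \<open>t\<close> times
  the first column from the second preserves it; \<open>t\<close> near \<open>b0 / a\<close> makes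
  \<open>b\<close> small, and \<open>a * e = 1 + b * c\<close> then bounds \<open>e\<close>.\<close>

lemma unimodular_completion:
  assumes "d > 0" "a \<in> quad_int_ring d" "c \<in> quad_int_ring d" "a \<noteq> 0"
    and "coprime (qnorm a) (qnorm c)" "cmod c \<le> T" "cmod a \<le> T" "T \<ge> 1"
  obtains b e where "b \<in> quad_int_ring d" "e \<in> quad_int_ring d" "a * e - b * c = 1"
    "cmod b \<le> (2 + cmod (omega d)) * T" "cmod e \<le> (2 + cmod (omega d)) * T"
proof -
  define W where "W = 1 + cmod (omega d)"
  obtain x y where "x * qnorm a + y * qnorm c = 1"
    using bezout_int[of "qnorm a" "qnorm c"] assms(5) by auto
  then have "complex_of_real (of_int x * of_int (qnorm a) + of_int y * of_int (qnorm c)) = 1"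
    by (metis of_int_1 of_int_add of_int_mult of_real_1)
  then have 1: "of_int x * (a * cnj a) + of_int y * (c * cnj c) = 1"
    unfolding of_int_qnorm[OF assms(1,2)] of_int_qnorm[OF assms(1,3)]
    by (simp only: of_real_add of_real_mult of_real_of_int_eq complex_norm_square)
  define b0 e0 where "b0 = - (of_int y * cnj c)" and "e0 = of_int x * cnj a"
  have 0: "b0 \<in> quad_int_ring d" "e0 \<in> quad_int_ring d" "a * e0 - b0 * c = 1"
    using 1 assms unfolding b0_def e0_def
    by (auto simp: algebra_simps
        intro!: quad_int_ring_closed(2,3) of_int_in_quad_int_ring cnj_in_quad_int_ring)
  obtain t where t: "t \<in> quad_int_ring d" "cmod (b0 / a - t) \<le> W"
    using quad_int_ring_covering[OF assms(1)] unfolding W_def by metis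
  define b e where "b = b0 - t * a" and "e = e0 - t * c"
  have be: "b \<in> quad_int_ring d" "e \<in> quad_int_ring d"
    unfolding b_def e_def using 0 t assms
    by (auto intro!: diff_in_quad_int_ring quad_int_ring_closed(3))
  have det: "a * e - b * c = 1" using 0(3) by (simp add: b_def e_def algebra_simps)
  have "b = (b0 / a - t) * a" using assms(4) by (simp add: b_def field_simps)
  then have b: "cmod b \<le> W * cmod a" using t(2) by (simp add: norm_mult mult_right_mono)
  have W: "W \<ge> 1" by (simp add: W_def)
  have "cmod a * cmod e = cmod (1 + b * c)"
    using det by (simp add: norm_mult[symmetric] algebra_simps)
  also have "\<dots> \<le> 1 + cmod b * cmod c" by (metis norm_triangle_ineq norm_mult norm_one)
  also have "\<dots> \<le> cmod a * 1 + W * cmod a * T"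
    using b one_le_cmod[OF assms(1,2,4)] W assms(6,8) by (intro add_mono mult_mono) auto
  also have "\<dots> = cmod a * (1 + W * T)" by (simp add: algebra_simps)
  finally have "cmod e \<le> 1 + W * T" using assms(4) by simp
  also have "\<dots> \<le> (2 + cmod (omega d)) * T" using assms(8) by (simp add: W_def algebra_simps)
  finally have e: "cmod e \<le> (2 + cmod (omega d)) * T" .
  have "cmod b \<le> W * T" using b W assms(7) by (smt (verit) mult_left_mono)
  also have "\<dots> \<le> (2 + cmod (omega d)) * T" using assms(8) by (intro mult_right_mono) (auto simp: W_def)
  finally show ?thesis using that be det e by blast
qed

section \<open>Sieving out pairs whose norms share a prime\<close>

text \<open>If \<open>k + m * v\<close> and \<open>k + m * w\<close> lie in the same one of the two
  subgroups, then \<open>p\<close> divides the norm of \<open>m * (v - w)\<close>, hence that of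
  \<open>v - w\<close>. So each subgroup contributes a set separated by \<open>sqrt p\<close>. The
  bound does not depend on \<open>m\<close>, which keeps the sieve uniform in
  \<open>Y\<close>.\<close>

lemma card_prime_dvd_qnorm_affine_le:
  fixes p :: int
  assumes "d > 0" "prime p" "\<not> p dvd m" "sqrt (of_int p) \<le> R" "k \<in> quad_int_ring d"
  shows "real (card {v \<in> quad_int_ring d. cmod v \<le> R \<and> p dvd qnorm (k + of_int m * v)})
    \<le> 72 * R\<^sup>2 / of_int p"
proof -
  obtain L1 L2 where L: "{z \<in> quad_int_ring d. p dvd qnorm z} = L1 \<union> L2"
    "\<And>x y. x \<in> L1 \<Longrightarrow> y \<in> L1 \<Longrightarrow> x - y \<in> L1" "\<And>x y. x \<in> L2 \<Longrightarrow> y \<in> L2 \<Longrightarrow> x - y \<in> L2"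
    using prime_dvd_qnorm_two_subgroups[OF assms(1,2)] by metis
  define S where "S L = {v \<in> quad_int_ring d. cmod v \<le> R \<and> k + of_int m * v \<in> L}" for L
  have p0: "p > 0" using assms(2) by (rule prime_gt_0_int)
  have S: "real (card (S L)) \<le> 36 * R\<^sup>2 / of_int p"
    if sub: "L \<subseteq> {z \<in> quad_int_ring d. p dvd qnorm z}"
      and diff: "\<And>x y. x \<in> L \<Longrightarrow> y \<in> L \<Longrightarrow> x - y \<in> L" for L
  proof -
    have "sqrt (of_int p) \<le> cmod (v - w)" if vw: "v \<in> S L" "w \<in> S L" "v \<noteq> w" for v w
    proof -
      have O: "v - w \<in> quad_int_ring d" using vw by (auto simp: S_def intro: diff_in_quad_int_ring)
      have "(k + of_int m * v) - (k + of_int m * w) \<in> L"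
        by (rule diff) (use vw in \<open>simp_all add: S_def\<close>)
      then have "of_int m * (v - w) \<in> L" by (simp add: algebra_simps)
      then have "p dvd qnorm (of_int m * (v - w))" using sub by blast
      then have "p dvd m\<^sup>2 * qnorm (v - w)" by (simp only: qnorm_mult_of_int[OF assms(1) O])
      then have "p dvd qnorm (v - w)"
        using assms(2,3) by (simp add: prime_dvd_mult_iff prime_dvd_power_iff)
      then show ?thesis using sqrt_le_cmod[OF assms(1) O] vw(3) by simp
    qed
    then have "real (card (S L)) \<le> 36 * R\<^sup>2 / (sqrt (of_int p))\<^sup>2"
      using p0 assms(4) by (intro separated_card_le') (auto simp: S_def)
    then show ?thesis using p0 by simp
  qed
  have fin: "finite (S L)" for L
    using finite_quad_int_ring_le[OF assms(1), of R] by (rule finite_subset[rotated]) (auto simp: S_def)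
  have "{v \<in> quad_int_ring d. cmod v \<le> R \<and> p dvd qnorm (k + of_int m * v)} \<subseteq> S L1 \<union> S L2"
  proof
    fix v assume v: "v \<in> {v \<in> quad_int_ring d. cmod v \<le> R \<and> p dvd qnorm (k + of_int m * v)}"
    then have "k + of_int m * v \<in> L1 \<union> L2"
      unfolding L(1)[symmetric] using assms(5)
      by (auto intro!: quad_int_ring_closed(1,3) of_int_in_quad_int_ring)
    then show "v \<in> S L1 \<union> S L2" using v by (auto simp: S_def)
  qed
  then have "card {v \<in> quad_int_ring d. cmod v \<le> R \<and> p dvd qnorm (k + of_int m * v)} \<le> card (S L1 \<union> S L2)"
    using fin by (intro card_mono) auto
  also have "\<dots> \<le> card (S L1) + card (S L2)" by (rule card_Un_le)
  finally show ?thesis using S[of L1] S[of L2] L by (simp add: field_simps)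
qed

text \<open>Telescoping: 1 / (n + 1)^2 is at most 1 / n - 1 / (n + 1). The term
  \<open>- 1 / N\<close> is what carries the induction.\<close>

lemma sum_inverse_squares_tail_le:
  assumes "Y > 0" "Y \<le> N"
  shows "(\<Sum>n\<in>{Y<..N}. 1 / (real n)\<^sup>2) \<le> 1 / Y - 1 / N"
  using assms(2)
proof (induction N rule: dec_induct)
  case base
  show ?case by simp
next
  case (step n)
  have "{Y<..Suc n} = insert (Suc n) {Y<..n}" using step by auto
  then have "(\<Sum>k\<in>{Y<..Suc n}. 1 / (real k)\<^sup>2) \<le> 1 / (real (Suc n))\<^sup>2 + (1 / Y - 1 / n)"
    using step by simp
  also have "1 / (real (Suc n))\<^sup>2 \<le> 1 / (real n * real (Suc n))"
    using assms(1) step by (intro divide_left_mono) (simp_all add: power2_eq_square)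
  also have "1 / (real n * real (Suc n)) = 1 / n - 1 / Suc n"
    using assms(1) step by (simp add: field_simps)
  finally show ?case by simp
qed

text \<open>There are at least R^4 / (8 W^4) pairs in all, and at most 72^2 R^4 / Y of them share a
  prime. As 82944 = 16 * 72^2, the condition on \<open>Y\<close> limits the loss to half of the main
  term.\<close>

lemma coprime_pairs_lower:
  assumes "d > 0" and W: "W = 1 + cmod (omega d)"
    and Y: "real Y \<ge> 82944 * W ^ 4" and R: "R \<ge> 2 * W"
  defines "V \<equiv> {v \<in> quad_int_ring d. cmod v \<le> R - 1}"
    and "U \<equiv> {u \<in> quad_int_ring d. cmod u \<le> R} - {0}"
  shows "R ^ 4 / (16 * W ^ 4) \<le> real (card {(v, u) \<in> V \<times> U.
    coprime (qnorm (1 + of_int (fact Y) * v)) (qnorm (of_int (fact Y) * u))})"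
    (is "_ \<le> real (card ?G)")
proof -
  define M :: int where "M = fact Y"
  \<comment> \<open>A common prime divides the norm of \<open>u\<close>, which is nonzero because
    \<open>U\<close> omits 0, so it is at most R^2. This makes \<open>P\<close> finite and gives the
    condition \<open>sqrt p \<le> R\<close> needed for packing.\<close>
  define N where "N = nat \<lfloor>R\<^sup>2\<rfloor>"
  define P where "P = {p \<in> {Y<..N}. prime (int p)}"
  define Vp where "Vp p = {v \<in> V. int p dvd qnorm (1 + of_int M * v)}" for p :: nat
  define Up where "Up p = {u \<in> U. int p dvd qnorm u}" for p :: nat
  have W1: "W \<ge> 1" by (simp add: W)
  have R2: "R \<ge> 2" using W1 R by linarith
  have Y0: "Y > 0" using Y W1 by (intro gr0I) (auto simp: power_le_zero_eq)
  have finV: "finite V" unfolding V_def by (rule finite_quad_int_ring_le[OF assms(1)])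
  have finU: "finite U" unfolding U_def using finite_quad_int_ring_le[OF assms(1)] by simp
  have dvdM: "\<not> int p dvd M" if "p \<in> P" for p
  proof
    assume dvd: "int p dvd M"
    have "prime p" using that by (simp add: P_def)
    moreover have "p dvd fact Y" using dvd unfolding M_def by (metis of_nat_dvd_iff of_nat_fact)
    ultimately have "p \<le> Y" by (simp add: prime_dvd_fact_iff)
    then show False using that by (simp add: P_def)
  qed
  have small: "sqrt (of_int (int p)) \<le> R" if "p \<in> P" for p
  proof (rule real_le_lsqrt)
    have "int p \<le> \<lfloor>R\<^sup>2\<rfloor>" using that by (auto simp: P_def N_def)
    then show "of_int (int p) \<le> R\<^sup>2" by (simp add: le_floor_iff)
  qed (use R2 in auto)
  have Vp: "real (card (Vp p)) \<le> 72 * R\<^sup>2 / p" if "p \<in> P" for p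
  proof -
    let ?A = "{v \<in> quad_int_ring d. cmod v \<le> R \<and> int p dvd qnorm (1 + of_int M * v)}"
    have "finite ?A" using finite_quad_int_ring_le[OF assms(1), of R] by (rule finite_subset[rotated]) auto
    then have "card (Vp p) \<le> card ?A" by (rule card_mono) (auto simp: Vp_def V_def)
    also have "real (card ?A) \<le> 72 * R\<^sup>2 / of_int (int p)"
      using dvdM[OF that] small[OF that] that assms(1)
      by (intro card_prime_dvd_qnorm_affine_le zero_one_in_quad_int_ring) (auto simp: P_def)
    finally show ?thesis by simp
  qed
  have Up: "real (card (Up p)) \<le> 72 * R\<^sup>2 / p" if "p \<in> P" for p
  proof -
    let ?A = "{v \<in> quad_int_ring d. cmod v \<le> R \<and> int p dvd qnorm (0 + of_int 1 * v)}"
    have "finite ?A" using finite_quad_int_ring_le[OF assms(1), of R] by (rule finite_subset[rotated]) auto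
    then have "card (Up p) \<le> card ?A" by (rule card_mono) (auto simp: Up_def U_def)
    also have "real (card ?A) \<le> 72 * R\<^sup>2 / of_int (int p)"
      using small[OF that] that assms(1)
      by (intro card_prime_dvd_qnorm_affine_le zero_one_in_quad_int_ring)
        (auto simp: P_def dest: not_prime_unit)
    finally show ?thesis by simp
  qed
  have "V \<times> U - ?G \<subseteq> (\<Union>p\<in>P. Vp p \<times> Up p)"
  proof
    fix q assume q: "q \<in> V \<times> U - ?G"
    obtain v u where vu: "q = (v, u)" "v \<in> V" "u \<in> U" using q by blast
    have O: "v \<in> quad_int_ring d" "u \<in> quad_int_ring d" "u \<noteq> 0" "cmod u \<le> R"
      using vu by (auto simp: V_def U_def)
    have "\<not> coprime (qnorm (1 + of_int M * v)) (qnorm (of_int M * u))"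
      using q vu unfolding M_def by auto
    then obtain c where c: "c dvd qnorm (1 + of_int M * v)" "c dvd qnorm (of_int M * u)" "\<not> is_unit c"
      by (rule not_coprimeE)
    have qM: "qnorm (of_int M * u) = M\<^sup>2 * qnorm u" by (rule qnorm_mult_of_int[OF assms(1) O(2)])
    moreover have "M \<noteq> 0" by (simp add: M_def)
    ultimately have "qnorm (of_int M * u) \<noteq> 0" using qnorm_pos[OF assms(1) O(2,3)] by simp
    then have "c \<noteq> 0" using c(2) by auto
    then obtain p' where p': "prime p'" "p' dvd c" using c(3) prime_divisorE by blast
    define p where "p = nat p'"
    have p: "p' = int p" using prime_gt_0_int[OF p'(1)] by (simp add: p_def)
    have pV: "int p dvd qnorm (1 + of_int M * v)" and pU: "int p dvd M\<^sup>2 * qnorm u"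
      using dvd_trans[OF p'(2) c(1)] dvd_trans[OF p'(2) c(2)] unfolding qM p by blast+
    \<comment> \<open>The norm of \<open>1 + M * v\<close> is 1 modulo \<open>M\<close>. Hence
      \<open>p\<close> does not divide \<open>M\<close>, so it must divide \<open>qnorm u\<close>,
      and \<open>p > Y\<close> because \<open>M\<close> is the factorial of
      \<open>Y\<close>.\<close>
    have ndvd: "\<not> int p dvd M"
    proof
      assume "int p dvd M"
      obtain k where "qnorm (1 + of_int M * v) = 1 + M * k"
        using qnorm_one_add_mult[OF assms(1) O(1)] by blast
      then have "int p dvd 1"
        using pV \<open>int p dvd M\<close> by (metis dvd_add_left_iff dvd_mult2)
      then show False using p p'(1) not_prime_unit by blast
    qed
    then have pU: "int p dvd qnorm u"
      using pU p'(1) unfolding p by (simp add: prime_dvd_mult_iff prime_dvd_power_iff)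
    have "p > Y"
    proof (rule ccontr)
      assume "\<not> p > Y"
      then have "p dvd fact Y" using prime_gt_0_int[OF p'(1)] p by (intro dvd_fact) auto
      then have "int p dvd M" unfolding M_def by (metis of_nat_dvd_iff of_nat_fact)
      then show False using ndvd by blast
    qed
    moreover have "p \<le> N"
    proof -
      have "int p \<le> qnorm u" using pU qnorm_pos[OF assms(1) O(2,3)] zdvd_imp_le by blast
      also have "qnorm u \<le> \<lfloor>R\<^sup>2\<rfloor>" unfolding qnorm_def using O(4) by (intro floor_mono power_mono) auto
      finally show ?thesis by (simp add: N_def)
    qed
    ultimately have "p \<in> P" using p p'(1) by (simp add: P_def)
    then show "q \<in> (\<Union>p\<in>P. Vp p \<times> Up p)" using vu pV pU by (auto simp: Vp_def Up_def)
  qed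
  then have "card (V \<times> U - ?G) \<le> card (\<Union>p\<in>P. Vp p \<times> Up p)"
    using finV finU by (intro card_mono) (auto simp: P_def Vp_def Up_def)
  also have "\<dots> \<le> (\<Sum>p\<in>P. card (Vp p \<times> Up p))"
    by (rule card_UN_le) (simp add: P_def)
  finally have "real (card (V \<times> U - ?G)) \<le> (\<Sum>p\<in>P. real (card (Vp p)) * real (card (Up p)))"
    by (simp add: card_cartesian_product flip: of_nat_mult of_nat_sum)
  also have "\<dots> \<le> (\<Sum>p\<in>P. (72 * R\<^sup>2 / p) * (72 * R\<^sup>2 / p))"
    using Vp Up by (intro sum_mono mult_mono) auto
  also have "\<dots> = 5184 * R ^ 4 * (\<Sum>p\<in>P. 1 / (real p)\<^sup>2)"
    by (simp add: sum_distrib_left power2_eq_square power4_eq_xxxx mult.assoc)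
  also have "\<dots> \<le> 5184 * R ^ 4 * (1 / Y)"
  proof (rule mult_left_mono)
    show "(\<Sum>p\<in>P. 1 / (real p)\<^sup>2) \<le> 1 / Y"
    proof (cases "Y \<le> N")
      case True
      have "(\<Sum>p\<in>P. 1 / (real p)\<^sup>2) \<le> (\<Sum>p\<in>{Y<..N}. 1 / (real p)\<^sup>2)"
        by (rule sum_mono2) (auto simp: P_def)
      also have "\<dots> \<le> 1 / Y - 1 / N" by (rule sum_inverse_squares_tail_le[OF Y0 True])
      finally show ?thesis by (smt (verit) of_nat_0_le_iff divide_nonneg_nonneg)
    next
      case False
      then have "P = {}" by (auto simp: P_def)
      then show ?thesis by simp
    qed
  qed (use R2 in simp)
  also have "\<dots> \<le> 5184 * R ^ 4 * (1 / (82944 * W ^ 4))"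
    using Y Y0 W1 by (intro mult_left_mono divide_left_mono) auto
  finally have bad: "real (card (V \<times> U - ?G)) \<le> R ^ 4 / (16 * W ^ 4)"
    by (simp add: field_simps)
  \<comment> \<open>Two losses enter the main term. Passing from \<open>R\<close> to
    \<open>R - 1\<close> at most halves the radius, and deleting 0 from \<open>U\<close> at most
    halves the bound \<open>(R / W)^2\<close>, which is at least 4.\<close>
  have "(R / (2 * W))\<^sup>2 \<le> ((R - 1) / W)\<^sup>2"
    using R2 W1 by (intro power_mono) (simp_all add: field_simps)
  also have "\<dots> \<le> real (card V)"
    unfolding V_def W using R2 by (intro card_quad_int_ring_ge assms) simp
  finally have V: "(R / (2 * W))\<^sup>2 \<le> real (card V)" .
  have "(R / W)\<^sup>2 \<le> real (card {u \<in> quad_int_ring d. cmod u \<le> R})"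
    unfolding W using R2 by (intro card_quad_int_ring_ge assms) simp
  also have "\<dots> \<le> real (card U) + 1"
    unfolding U_def using diff_card_le_card_Diff[of "{0}" "{u \<in> quad_int_ring d. cmod u \<le> R}"] by simp
  finally have "(R / W)\<^sup>2 - 1 \<le> real (card U)" by simp
  moreover have "2\<^sup>2 \<le> (R / W)\<^sup>2" using R W1 by (intro power_mono) (simp_all add: field_simps)
  ultimately have U: "(R / W)\<^sup>2 / 2 \<le> real (card U)" by simp
  have "R ^ 4 / (8 * W ^ 4) = (R / (2 * W))\<^sup>2 * ((R / W)\<^sup>2 / 2)"
    by (simp add: power2_eq_square power4_eq_xxxx mult.assoc)
  also have "\<dots> \<le> real (card V) * real (card U)"
    using V U by (intro mult_mono) auto
  also have "\<dots> = real (card (V \<times> U))" by (simp add: card_cartesian_product)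
  also have "card (V \<times> U) \<le> card ?G + card (V \<times> U - ?G)"
  proof -
    have eq: "?G \<union> (V \<times> U - ?G) = V \<times> U" by auto
    show ?thesis using card_Un_le[of ?G "V \<times> U - ?G"] unfolding eq .
  qed
  finally have "R ^ 4 / (8 * W ^ 4) \<le> real (card ?G) + real (card (V \<times> U - ?G))" by simp
  moreover have "R ^ 4 / (8 * W ^ 4) = 2 * (R ^ 4 / (16 * W ^ 4))" by simp
  ultimately show ?thesis using bad by linarith
qed

section \<open>From coprime pairs to the lower bound\<close>

text \<open>The column \<open>(1 + M * v, M * u)\<close> determines the pair, and its entries have
  modulus at most \<open>M * R\<close>: the radius \<open>R - 1\<close> for \<open>v\<close> leaves
  room for the summand 1. Completing it costs the factor \<open>2 + cmod (omega d)\<close> in the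
  height.\<close>

lemma count_height_ge_card_coprime_pairs:
  assumes "d > 0" "M \<ge> 3" "R \<ge> 1"
  defines "V \<equiv> {v \<in> quad_int_ring d. cmod v \<le> R - 1}"
    and "U \<equiv> {u \<in> quad_int_ring d. cmod u \<le> R} - {0}"
  shows "card {(v, u) \<in> V \<times> U. coprime (qnorm (1 + of_int M * v)) (qnorm (of_int M * u))}
    \<le> count_height d ((2 + cmod (omega d)) * (of_int M * R))" (is "card ?G \<le> count_height d ?H")
proof -
  \<comment> \<open>Since \<open>M \<ge> 3\<close>, no two of the \<open>a v\<close> are negatives of each other, so no pair is lost in
    passing from matrices to classes modulo sign.\<close>
  define a c :: "complex \<Rightarrow> complex" where "a v = 1 + of_int M * v" and "c u = of_int M * u" for v u
  have a_neq: "a v \<noteq> - a v'" if "v \<in> quad_int_ring d" "v' \<in> quad_int_ring d" for v v'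
  proof
    assume "a v = - a v'"
    then have sum: "of_int M * (v + v') = - 2" by (simp add: a_def algebra_simps) algebra
    then have "v + v' \<noteq> 0" by auto
    then have "1 \<le> cmod (v + v')" using that by (intro one_le_cmod[OF assms(1)] quad_int_ring_closed)
    then have "of_int M * 1 \<le> of_int M * cmod (v + v')" using assms(2) by (intro mult_left_mono) auto
    also have "\<dots> = cmod (of_int M * (v + v'))" using assms(2) by (simp add: norm_mult)
    finally show False using assms(2) unfolding sum by simp
  qed
  define good where "good q A \<longleftrightarrow>
    A \<in> carrier (SL2 d) \<and> mat_height A \<le> ?H \<and> A$1$1 = a (fst q) \<and> A$2$1 = c (snd q)" for q A
  have "\<exists>A. good q A"
    if "q \<in> ?G" for q
  proof -
    obtain v u where q: "q = (v, u)" by (metis prod.collapse)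
    have vu: "v \<in> quad_int_ring d" "u \<in> quad_int_ring d" "cmod v \<le> R - 1" "cmod u \<le> R"
      "coprime (qnorm (a v)) (qnorm (c u))"
      using that by (auto simp: q V_def U_def a_def c_def)
    have O: "a v \<in> quad_int_ring d" "c u \<in> quad_int_ring d"
      unfolding a_def c_def using vu
      by (auto intro!: quad_int_ring_closed(1,3) of_int_in_quad_int_ring zero_one_in_quad_int_ring)
    have "a v \<noteq> 0" using a_neq[OF vu(1) vu(1)] by auto
    have "cmod (a v) \<le> 1 + of_int M * cmod v"
      using norm_triangle_ineq[of 1 "of_int M * v"] assms(2) by (simp add: a_def norm_mult)
    also have "\<dots> \<le> of_int M * 1 + of_int M * (R - 1)"
      using vu(3) assms(2) by (intro add_mono mult_left_mono) auto
    also have "\<dots> = of_int M * R" by (simp add: algebra_simps)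
    finally have ca: "cmod (a v) \<le> of_int M * R" .
    have cc: "cmod (c u) \<le> of_int M * R"
      using vu(4) assms(2) by (simp add: c_def norm_mult)
    have T: "1 * 1 \<le> of_int M * R" using assms(2,3) by (intro mult_mono) auto
    obtain b e where be: "b \<in> quad_int_ring d" "e \<in> quad_int_ring d" "a v * e - b * c u = 1"
      "cmod b \<le> ?H" "cmod e \<le> ?H"
      using unimodular_completion[OF assms(1) O \<open>a v \<noteq> 0\<close> vu(5) cc ca] T by auto
    have "1 * (of_int M * R) \<le> ?H" using T by (intro mult_right_mono) auto
    then have H: "cmod (a v) \<le> ?H" "cmod (c u) \<le> ?H" using ca cc by linarith+
    define A :: "complex^2^2" where "A = vector [vector [a v, b], vector [c u, e]]"
    have A: "A$1$1 = a v" "A$1$2 = b" "A$2$1 = c u" "A$2$2 = e" by (simp_all add: A_def)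
    have "A \<in> carrier (SL2 d)" using be O by (simp add: SL2_simps forall_2 A det_2)
    moreover have "mat_height A \<le> ?H"
      unfolding mat_height_le_iff forall_2 A using H be by blast
    ultimately show ?thesis using A q unfolding good_def by auto
  qed
  then have "\<exists>f. \<forall>q\<in>?G. good q (f q)" by (intro bchoice ballI)
  then obtain f where "\<forall>q\<in>?G. good q (f q)" by (rule exE)
  then have f: "\<And>q. q \<in> ?G \<Longrightarrow> f q \<in> carrier (SL2 d)" "\<And>q. q \<in> ?G \<Longrightarrow> mat_height (f q) \<le> ?H"
    "\<And>q. q \<in> ?G \<Longrightarrow> f q $ 1 $ 1 = a (fst q)" "\<And>q. q \<in> ?G \<Longrightarrow> f q $ 2 $ 1 = c (snd q)"
    unfolding good_def by blast+
  have "inj_on (\<lambda>q. {f q, - f q}) ?G"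
  proof (rule inj_onI)
    fix q r assume qr: "q \<in> ?G" "r \<in> ?G" "{f q, - f q} = {f r, - f r}"
    have "fst q \<in> quad_int_ring d" "fst r \<in> quad_int_ring d" using qr(1,2) by (auto simp: V_def)
    then have "a (fst q) \<noteq> - a (fst r)" by (rule a_neq)
    then have "f q \<noteq> - f r" using f(3)[OF qr(1)] f(3)[OF qr(2)] by auto
    then have "f q = f r" using qr(3) by (auto simp: doubleton_eq_iff)
    then have "a (fst q) = a (fst r)" "c (snd q) = c (snd r)"
      using f(3,4)[OF qr(1)] f(3,4)[OF qr(2)] by auto
    then show "q = r" using assms(2) by (simp add: a_def c_def prod_eq_iff)
  qed
  moreover have "(\<lambda>q. {f q, - f q}) ` ?G \<subseteq> {A \<in> carrier (PSL2 d). height A \<le> ?H}"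
  proof
    fix X assume "X \<in> (\<lambda>q. {f q, - f q}) ` ?G"
    then obtain q where "q \<in> ?G" "X = {f q, - f q}" by (rule imageE)
    then show "X \<in> {A \<in> carrier (PSL2 d). height A \<le> ?H}"
      using f(1,2)[of q] unfolding carrier_PSL2 by (auto simp only: height_eq)
  qed
  ultimately show ?thesis
    unfolding count_height_def using finite_height_le[OF assms(1)] by (rule card_inj_on_le)
qed

text \<open>\<open>Y\<close> is chosen from \<open>W\<close> alone, so \<open>M\<close>,
  \<open>K\<close> and \<open>l\<close> depend only on \<open>d\<close>. The constant
  \<open>l\<close> is the proportion 1 / (16 W^4) of coprime pairs after rescaling by
  \<open>R = T / K\<close>.\<close>

lemma count_height_lower:
  assumes "d > 0"
  obtains l :: real where "l > 0" "eventually (\<lambda>T. l * T ^ 4 \<le> real (count_height d T)) at_top"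
proof -
  define W where "W = 1 + cmod (omega d)"
  obtain Y where Y: "real Y \<ge> 82944 * W ^ 4" using real_arch_simple by blast
  define M :: int where "M = fact Y"
  define K where "K = (2 + cmod (omega d)) * of_int M"
  define l where "l = 1 / (16 * W ^ 4 * K ^ 4)"
  have W1: "W \<ge> 1" by (simp add: W_def)
  have "1 \<le> W ^ 4" using W1 by (rule one_le_power)
  then have "3 \<le> Y" using Y by linarith
  then have "3 \<le> (fact Y :: nat)" using fact_ge_self by (rule order_trans)
  moreover have "M = int (fact Y)" by (simp add: M_def)
  ultimately have M: "M \<ge> 3" by linarith
  have K: "K > 0" using M by (simp add: K_def add_pos_nonneg)
  have "l > 0" using K W1 by (simp add: l_def)
  moreover have "l * T ^ 4 \<le> real (count_height d T)" if "T \<ge> 2 * W * K" for T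
  proof -
    have R: "T / K \<ge> 2 * W" using that K by (simp add: field_simps)
    have "l * T ^ 4 = (T / K) ^ 4 / (16 * W ^ 4)" using K W1 by (simp add: l_def power_divide field_simps)
    also have "\<dots> \<le> real (count_height d (K * (T / K)))"
      using coprime_pairs_lower[OF assms W_def Y R, folded M_def]
        count_height_ge_card_coprime_pairs[OF assms M, of "T / K"] R W1
      unfolding K_def mult.assoc by linarith
    finally show ?thesis using K by simp
  qed
  then have "eventually (\<lambda>T. l * T ^ 4 \<le> real (count_height d T)) at_top"
    by (rule eventually_at_top_linorderI)
  ultimately show ?thesis by (rule that)
qed

section \<open>Passing to the asymptotic statement\<close>

text \<open>Dividing by the positive \<open>g T\<close> bounds the quotient by 1 eventually, and
  with it the limsup.\<close>

lemma asymp_leI: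
  assumes "eventually (\<lambda>T. f T \<le> g T \<and> g T > 0) at_top"
  shows "asymp_le f g"
  unfolding asymp_le_def
  by (rule Limsup_bounded, rule eventually_mono[OF assms]) (simp add: one_ereal_def)

theorem theorem5p2:
  fixes d :: int
  assumes "d > 0" and "squarefree d"
  shows "\<exists>l1 l2 :: real. 0 < l1 \<and> l1 \<le> l2 \<and>
    asymp_le (\<lambda>T. l1 * T ^ 4) (\<lambda>T. real (count_height d T)) \<and>
    asymp_le (\<lambda>T. real (count_height d T)) (\<lambda>T. l2 * T ^ 4)"
proof -
  obtain l where l: "l > 0" "eventually (\<lambda>T. l * T ^ 4 \<le> real (count_height d T)) at_top"
    using count_height_lower[OF assms(1)] by blast
  \<comment> \<open>Taking the maximum yields \<open>l \<le> u\<close> without comparing the two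
    constants.\<close>
  define u where "u = max l 93312"
  have "asymp_le (\<lambda>T. l * T ^ 4) (\<lambda>T. real (count_height d T))"
  proof (rule asymp_leI, use l(2) eventually_gt_at_top[of 0] in eventually_elim)
    case (elim T)
    then have "0 < l * T ^ 4" using l(1) by simp
    then show ?case using elim(1) by linarith
  qed
  moreover have "asymp_le (\<lambda>T. real (count_height d T)) (\<lambda>T. u * T ^ 4)"
  proof (rule asymp_leI, use eventually_ge_at_top[of 1] in eventually_elim)
    case (elim T)
    have "real (count_height d T) \<le> 93312 * T ^ 4" by (rule count_height_upper[OF assms(1) elim])
    also have "\<dots> \<le> u * T ^ 4" by (intro mult_right_mono) (auto simp: u_def)
    finally show ?case using elim l(1) by (simp add: u_def)
  qed
  ultimately show ?thesis using l(1) by (intro exI[of _ l] exI[of _ u]) (simp add: u_def)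
qed

end
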